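(* Let $X_1,X_2$ be complex Banach spaces, $X=X_1\times X_2$, and let $\mathcal A=(A_{jk})_{j,k=1,2}$ and $\mathcal B=(B_{jk})_{j,k=1,2}$ be block operator matrices on $X$. Then $\mathcal A\times\mathcal B=\mathcal A\mathcal B$ (equality of linear operators on $X$, including equality of domains) if and only if the operator product $\mathcal A\mathcal B$ has a matrix representation.
   Context: All operators are linear and possibly unbounded, defined on linear subspaces; $\mathcal D(T)$ denotes the domain of $T$. $X=X_1\times X_2$ carries the norm $\|(x_1\ x_2)^t\|=(\|x_1\|^2+\|x_2\|^2)^{1/2}$. Block operator matrix: given linear operators $A_{jk}:\mathcal D(A_{jk})\subset X_k\to X_j$, $j,k=1,2$, the matrix $\mathcal A=(A_{jk})$ is called a block operator matrix on $X$, and is identified with the linear operator on $X$ with domain $\mathcal D(\mathcal A)=(\mathcal D(A_{11})\cap\mathcal D(A_{21}))\times(\mathcal D(A_{12})\cap\mathcal D(A_{22}))$ and action $\mathcal A(x_1\ x_2)^t=(A_{11}x_1+A_{12}x_2\ \ A_{21}x_1+A_{22}x_2)^t$. A linear operator on $X$ has a matrix representation if it equals (with the same domain) the operator induced by some block operator matrix on $X$. Operator product and sum have their natural domains: $\mathcal D(ST)=\{x\in\mathcal D(T): Tx\in\mathcal D(S)\}$ and $\mathcal D(S+T)=\mathcal D(S)\cap\mathcal D(T)$. Formal product: $\mathcal A\times\mathcal B$ is the block operator matrix whose $(j,l)$ entry is $\sum_{k=1}^2A_{jk}B_{kl}$. *)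

theory Defs
  imports "HOL-Analysis.Analysis"
begin

(* A complex Banach space is a real one with a compatible complex scalar multiplication. *)

class scaleC =
  fixes scaleC :: "complex \<Rightarrow> 'a \<Rightarrow> 'a"  (infixr "*\<^sub>C" 75)

class complex_banach = banach + scaleC +
  assumes scaleC_add_right: "a *\<^sub>C (x + y) = a *\<^sub>C x + a *\<^sub>C y"
    and scaleC_add_left: "(a + b) *\<^sub>C x = a *\<^sub>C x + b *\<^sub>C x"
    and scaleC_scaleC: "a *\<^sub>C b *\<^sub>C x = (a * b) *\<^sub>C x"
    and scaleR_scaleC: "scaleR r x = complex_of_real r *\<^sub>C x"
    and norm_scaleC: "norm (a *\<^sub>C x) = cmod a * norm x"

global_interpretation complex_vector:
  vector_space "scaleC :: complex \<Rightarrow> 'a \<Rightarrow> 'a::complex_banach"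
  by unfold_locales
    (simp_all add: scaleC_add_right scaleC_add_left scaleC_scaleC
      flip: scaleR_scaleC[of 1, simplified])

instantiation complex :: complex_banach
begin

definition scaleC_complex_def: "a *\<^sub>C (x::complex) = a * x"

instance
  by standard (simp_all add: scaleC_complex_def algebra_simps norm_mult scaleR_conv_of_real)

end

(* The library norm of the product type is sqrt ((norm x1)^2 + (norm x2)^2). *)

instantiation prod :: (complex_banach, complex_banach) complex_banach
begin

definition scaleC_prod_def: "a *\<^sub>C x = (a *\<^sub>C fst x, a *\<^sub>C snd x)"

instance
proof
  fix a b :: complex and r :: real and x y :: "'a \<times> 'b"
  show "a *\<^sub>C (x + y) = a *\<^sub>C x + a *\<^sub>C y"
    by (simp add: scaleC_prod_def scaleC_add_right)
  show "(a + b) *\<^sub>C x = a *\<^sub>C x + b *\<^sub>C x"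
    by (simp add: scaleC_prod_def scaleC_add_left)
  show "a *\<^sub>C b *\<^sub>C x = (a * b) *\<^sub>C x"
    by (simp add: scaleC_prod_def scaleC_scaleC)
  show "scaleR r x = complex_of_real r *\<^sub>C x"
    by (simp add: scaleC_prod_def scaleR_scaleC scaleR_prod_def)
  have "norm (a *\<^sub>C x) = sqrt ((cmod a)\<^sup>2 * ((norm (fst x))\<^sup>2 + (norm (snd x))\<^sup>2))"
    by (simp add: scaleC_prod_def norm_prod_def norm_scaleC power_mult_distrib distrib_left)
  then show "norm (a *\<^sub>C x) = cmod a * norm x"
    by (simp add: norm_prod_def real_sqrt_mult)
qed

end

(* A possibly unbounded operator is a partial function T with domain dom T, so that equality
   of operators includes equality of domains.  The operator product ST is the library
   composition of partial functions: dom (S \<circ>\<^sub>m T) = {x \<in> dom T. the (T x) \<in> dom S}. *)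

definition linear_operator :: "('a::complex_banach \<rightharpoonup> 'b::complex_banach) \<Rightarrow> bool" where
  "linear_operator T \<longleftrightarrow>
     complex_vector.subspace (dom T) \<and>
     (\<forall>x\<in>dom T. \<forall>y\<in>dom T. the (T (x + y)) = the (T x) + the (T y)) \<and>
     (\<forall>c. \<forall>x\<in>dom T. the (T (c *\<^sub>C x)) = c *\<^sub>C the (T x))"

definition op_plus :: "('a \<rightharpoonup> 'b) \<Rightarrow> ('a \<rightharpoonup> 'b::plus) \<Rightarrow> ('a \<rightharpoonup> 'b)"  (infixl "+\<^sub>m" 65) where
  "S +\<^sub>m T = (\<lambda>x. if x \<in> dom S \<inter> dom T then Some (the (S x) + the (T x)) else None)"

datatype ('a, 'b) block_matrix = Block
  (entry11: "'a \<rightharpoonup> 'a") (entry12: "'b \<rightharpoonup> 'a")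
  (entry21: "'a \<rightharpoonup> 'b") (entry22: "'b \<rightharpoonup> 'b")

definition block_operator_matrix ::
    "('a::complex_banach, 'b::complex_banach) block_matrix \<Rightarrow> bool" where
  "block_operator_matrix M \<longleftrightarrow>
     linear_operator (entry11 M) \<and> linear_operator (entry12 M) \<and>
     linear_operator (entry21 M) \<and> linear_operator (entry22 M)"

definition induced_operator ::
    "('a::plus, 'b::plus) block_matrix \<Rightarrow> ('a \<times> 'b \<rightharpoonup> 'a \<times> 'b)" where
  "induced_operator M = (\<lambda>(x1, x2).
     if (x1, x2) \<in> (dom (entry11 M) \<inter> dom (entry21 M)) \<times> (dom (entry12 M) \<inter> dom (entry22 M))
     then Some (the (entry11 M x1) + the (entry12 M x2),
                the (entry21 M x1) + the (entry22 M x2))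
     else None)"

definition has_matrix_representation ::
    "('a::complex_banach \<times> 'b::complex_banach \<rightharpoonup> 'a \<times> 'b) \<Rightarrow> bool" where
  "has_matrix_representation T \<longleftrightarrow>
     (\<exists>M. block_operator_matrix M \<and> T = induced_operator M)"

definition formal_product ::
    "('a::plus, 'b::plus) block_matrix \<Rightarrow> ('a, 'b) block_matrix \<Rightarrow> ('a, 'b) block_matrix" where
  "formal_product A B = Block
     ((entry11 A \<circ>\<^sub>m entry11 B) +\<^sub>m (entry12 A \<circ>\<^sub>m entry21 B))
     ((entry11 A \<circ>\<^sub>m entry12 B) +\<^sub>m (entry12 A \<circ>\<^sub>m entry22 B))
     ((entry21 A \<circ>\<^sub>m entry11 B) +\<^sub>m (entry22 A \<circ>\<^sub>m entry21 B))
     ((entry21 A \<circ>\<^sub>m entry12 B) +\<^sub>m (entry22 A \<circ>\<^sub>m entry22 B))"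

lemma linear_operatorI:
  assumes "T 0 = Some 0"
    and "\<And>x y u v. T x = Some u \<Longrightarrow> T y = Some v \<Longrightarrow> T (x + y) = Some (u + v)"
    and "\<And>c x u. T x = Some u \<Longrightarrow> T (c *\<^sub>C x) = Some (c *\<^sub>C u)"
  shows "linear_operator T"
  unfolding linear_operator_def complex_vector.subspace_def
  using assms by (auto simp: dom_def)

lemma linear_operatorD:
  assumes "linear_operator T"
  shows "T 0 = Some 0"
    and "T x = Some u \<Longrightarrow> T y = Some v \<Longrightarrow> T (x + y) = Some (u + v)"
    and "T x = Some u \<Longrightarrow> T (c *\<^sub>C x) = Some (c *\<^sub>C u)"
proof -
  have sub: "complex_vector.subspace (dom T)"
    and add: "\<And>x y. x \<in> dom T \<Longrightarrow> y \<in> dom T \<Longrightarrow> the (T (x + y)) = the (T x) + the (T y)"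
    and scale: "\<And>c x. x \<in> dom T \<Longrightarrow> the (T (c *\<^sub>C x)) = c *\<^sub>C the (T x)"
    using assms unfolding linear_operator_def by blast+
  have z: "0 \<in> dom T"
    using sub by (rule complex_vector.subspace_0)
  show "T 0 = Some 0"
    using z scale[OF z, of 0] by auto
  show "T (x + y) = Some (u + v)" if h: "T x = Some u" "T y = Some v"
  proof -
    have d: "x \<in> dom T" "y \<in> dom T" using h by auto
    then have "x + y \<in> dom T" using complex_vector.subspace_add[OF sub] by blast
    then show ?thesis using add[OF d] h by auto
  qed
  show "T (c *\<^sub>C x) = Some (c *\<^sub>C u)" if h: "T x = Some u"
  proof -
    have d: "x \<in> dom T" using h by auto
    then have "c *\<^sub>C x \<in> dom T" using complex_vector.subspace_scale[OF sub] by blast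
    then show ?thesis using scale[OF d, of c] h by auto
  qed
qed

lemma dom_op_comp: "dom (S \<circ>\<^sub>m T) = {x \<in> dom T. the (T x) \<in> dom S}"
  by (auto simp: map_comp_def split: option.splits)

lemma linear_operator_comp:
  assumes "linear_operator S" "linear_operator T"
  shows "linear_operator (S \<circ>\<^sub>m T)"
proof (rule linear_operatorI)
  show "(S \<circ>\<^sub>m T) 0 = Some 0"
    by (simp add: linear_operatorD(1)[OF assms(1)] linear_operatorD(1)[OF assms(2)])
next
  fix x y u v
  assume "(S \<circ>\<^sub>m T) x = Some u" "(S \<circ>\<^sub>m T) y = Some v"
  then obtain x' y' where "T x = Some x'" "S x' = Some u" "T y = Some y'" "S y' = Some v"
    unfolding map_comp_Some_iff by blast
  then show "(S \<circ>\<^sub>m T) (x + y) = Some (u + v)"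
    by (simp add: linear_operatorD(2)[OF assms(1)] linear_operatorD(2)[OF assms(2)])
next
  fix c x u
  assume "(S \<circ>\<^sub>m T) x = Some u"
  then obtain x' where "T x = Some x'" "S x' = Some u"
    unfolding map_comp_Some_iff by blast
  then show "(S \<circ>\<^sub>m T) (c *\<^sub>C x) = Some (c *\<^sub>C u)"
    by (simp add: linear_operatorD(3)[OF assms(1)] linear_operatorD(3)[OF assms(2)])
qed

lemma op_plus_Some_iff:
  "(S +\<^sub>m T) x = Some w \<longleftrightarrow> (\<exists>u v. S x = Some u \<and> T x = Some v \<and> w = u + v)"
  by (auto simp: op_plus_def)

lemma linear_operator_plus:
  assumes "linear_operator S" "linear_operator T"
  shows "linear_operator (S +\<^sub>m T)"
proof (rule linear_operatorI)
  show "(S +\<^sub>m T) 0 = Some 0"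
    using linear_operatorD(1)[OF assms(1)] linear_operatorD(1)[OF assms(2)]
    by (simp add: op_plus_Some_iff)
next
  fix x y u v
  assume "(S +\<^sub>m T) x = Some u" "(S +\<^sub>m T) y = Some v"
  then obtain u1 u2 v1 v2 where
    "S x = Some u1" "T x = Some u2" "u = u1 + u2" "S y = Some v1" "T y = Some v2" "v = v1 + v2"
    unfolding op_plus_Some_iff by blast
  then show "(S +\<^sub>m T) (x + y) = Some (u + v)"
    by (simp add: op_plus_Some_iff linear_operatorD(2)[OF assms(1)]
        linear_operatorD(2)[OF assms(2)] ac_simps)
next
  fix c x u
  assume "(S +\<^sub>m T) x = Some u"
  then obtain u1 u2 where "S x = Some u1" "T x = Some u2" "u = u1 + u2"
    unfolding op_plus_Some_iff by blast
  then show "(S +\<^sub>m T) (c *\<^sub>C x) = Some (c *\<^sub>C u)"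
    by (simp add: op_plus_Some_iff linear_operatorD(3)[OF assms(1)]
        linear_operatorD(3)[OF assms(2)] scaleC_add_right)
qed

lemma block_operator_matrix_formal_product:
  assumes "block_operator_matrix A" "block_operator_matrix B"
  shows "block_operator_matrix (formal_product A B)"
  using assms unfolding block_operator_matrix_def formal_product_def
  by (simp add: linear_operator_plus linear_operator_comp)

lemma induced_operator_Some_iff:
  "induced_operator M (x1, x2) = Some w \<longleftrightarrow>
    (\<exists>a b c d. entry11 M x1 = Some a \<and> entry12 M x2 = Some b \<and>
       entry21 M x1 = Some c \<and> entry22 M x2 = Some d \<and> w = (a + b, c + d))"
  by (auto simp: induced_operator_def)

lemma linear_operator_induced_operator:
  assumes "block_operator_matrix M"
  shows "linear_operator (induced_operator M)"
proof -
  have l: "linear_operator (entry11 M)" "linear_operator (entry12 M)"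
    "linear_operator (entry21 M)" "linear_operator (entry22 M)"
    using assms unfolding block_operator_matrix_def by auto
  note D = linear_operatorD[OF l(1)] linear_operatorD[OF l(2)]
    linear_operatorD[OF l(3)] linear_operatorD[OF l(4)]
  show ?thesis
  proof (rule linear_operatorI)
    show "induced_operator M 0 = Some 0"
      by (simp add: zero_prod_def induced_operator_Some_iff D(1,4,7,10))
  next
    fix x y u v
    assume h: "induced_operator M x = Some u" "induced_operator M y = Some v"
    obtain x1 x2 y1 y2 where xy: "x = (x1, x2)" "y = (y1, y2)"
      by (metis surj_pair)
    obtain a b c d where 1: "entry11 M x1 = Some a" "entry12 M x2 = Some b"
      "entry21 M x1 = Some c" "entry22 M x2 = Some d" "u = (a + b, c + d)"
      using h(1) unfolding xy induced_operator_Some_iff by blast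
    obtain a' b' c' d' where 2: "entry11 M y1 = Some a'" "entry12 M y2 = Some b'"
      "entry21 M y1 = Some c'" "entry22 M y2 = Some d'" "v = (a' + b', c' + d')"
      using h(2) unfolding xy induced_operator_Some_iff by blast
    have "entry11 M (x1 + y1) = Some (a + a')" "entry12 M (x2 + y2) = Some (b + b')"
      "entry21 M (x1 + y1) = Some (c + c')" "entry22 M (x2 + y2) = Some (d + d')"
      using 1 2 by (auto intro: D(2,5,8,11))
    then show "induced_operator M (x + y) = Some (u + v)"
      by (simp add: xy induced_operator_Some_iff 1(5) 2(5) ac_simps)
  next
    fix k x u
    assume h: "induced_operator M x = Some u"
    obtain x1 x2 where x: "x = (x1, x2)"
      by (metis surj_pair)
    obtain a b c d where 1: "entry11 M x1 = Some a" "entry12 M x2 = Some b"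
      "entry21 M x1 = Some c" "entry22 M x2 = Some d" "u = (a + b, c + d)"
      using h unfolding x induced_operator_Some_iff by blast
    have "entry11 M (k *\<^sub>C x1) = Some (k *\<^sub>C a)" "entry12 M (k *\<^sub>C x2) = Some (k *\<^sub>C b)"
      "entry21 M (k *\<^sub>C x1) = Some (k *\<^sub>C c)" "entry22 M (k *\<^sub>C x2) = Some (k *\<^sub>C d)"
      using 1 by (auto intro: D(3,6,9,12))
    then show "induced_operator M (k *\<^sub>C x) = Some (k *\<^sub>C u)"
      by (simp add: x scaleC_prod_def induced_operator_Some_iff 1(5) scaleC_add_right)
  qed
qed

end

(* The formal product is always a restriction of the operator product.  The domain of an operator
   with a matrix representation is a product of subspaces, so with (x1, x2) it contains (x1, 0) and
   (0, x2); on such vectors no cancellation can occur in the sums formed by B, and membership in the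
   domain of the operator product means that every summand of the formal product is defined. *)

theory Submission
  imports Defs
begin

text \<open>Once all eight summands are defined, additivity of each entry of \<open>A\<close> merges
  its values at \<open>b11\<close>, \<open>b12\<close> or at \<open>b21\<close>, \<open>b22\<close>
  into the value at the sum. The converse can fail: a sum may lie in a domain that its terms
  miss.\<close>

lemma formal_product_map_le:
  assumes "block_operator_matrix A"
  shows "induced_operator (formal_product A B) \<subseteq>\<^sub>m induced_operator A \<circ>\<^sub>m induced_operator B"
proof -
  have lin: "linear_operator (entry11 A)" "linear_operator (entry12 A)"
    "linear_operator (entry21 A)" "linear_operator (entry22 A)"
    using assms unfolding block_operator_matrix_def by auto
  have "(induced_operator A \<circ>\<^sub>m induced_operator B) (x1, x2) = Some w"
    if h: "induced_operator (formal_product A B) (x1, x2) = Some w" for x1 x2 w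
  proof -
    obtain b11 b21 b12 b22 where
      B: "entry11 B x1 = Some b11" "entry21 B x1 = Some b21"
        "entry12 B x2 = Some b12" "entry22 B x2 = Some b22"
      using h by (auto simp: induced_operator_Some_iff formal_product_def op_plus_Some_iff
          map_comp_Some_iff)
    obtain a b c d a' b' c' d' where
      A: "entry11 A b11 = Some a" "entry12 A b21 = Some b"
        "entry21 A b11 = Some c" "entry22 A b21 = Some d"
        "entry11 A b12 = Some a'" "entry12 A b22 = Some b'"
        "entry21 A b12 = Some c'" "entry22 A b22 = Some d'"
      and w: "w = ((a + b) + (a' + b'), (c + d) + (c' + d'))"
      using h B by (auto simp: induced_operator_Some_iff formal_product_def op_plus_Some_iff
          map_comp_Some_iff)
    have "induced_operator B (x1, x2) = Some (b11 + b12, b21 + b22)"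
      using B by (simp add: induced_operator_Some_iff)
    moreover have "induced_operator A (b11 + b12, b21 + b22) = Some w"
      using A w linear_operatorD(2)[OF lin(1)] linear_operatorD(2)[OF lin(2)]
        linear_operatorD(2)[OF lin(3)] linear_operatorD(2)[OF lin(4)]
      by (simp add: induced_operator_Some_iff ac_simps)
    ultimately show ?thesis
      by simp
  qed
  then show ?thesis
    by (fastforce simp: map_le_def)
qed

lemma dom_induced_operator:
  "dom (induced_operator M) =
     (dom (entry11 M) \<inter> dom (entry21 M)) \<times> (dom (entry12 M) \<inter> dom (entry22 M))"
  by (auto simp: induced_operator_def split: if_splits)

lemma induced_operator_dom_components:
  assumes "block_operator_matrix M" "(x1, x2) \<in> dom (induced_operator M)"
  shows "(x1, 0) \<in> dom (induced_operator M)" "(0, x2) \<in> dom (induced_operator M)"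
  using assms
  by (auto simp: dom_induced_operator block_operator_matrix_def dest: linear_operatorD(1))

lemma formal_product_dom:
  assumes "block_operator_matrix B"
    and 1: "(x1, 0) \<in> dom (induced_operator A \<circ>\<^sub>m induced_operator B)"
    and 2: "(0, x2) \<in> dom (induced_operator A \<circ>\<^sub>m induced_operator B)"
  shows "(x1, x2) \<in> dom (induced_operator (formal_product A B))"
proof -
  have zero: "entry11 B 0 = Some 0" "entry12 B 0 = Some 0"
    "entry21 B 0 = Some 0" "entry22 B 0 = Some 0"
    using assms(1) linear_operatorD(1) unfolding block_operator_matrix_def by blast+
  obtain w1 w2 where "(induced_operator A \<circ>\<^sub>m induced_operator B) (x1, 0) = Some w1"
    "(induced_operator A \<circ>\<^sub>m induced_operator B) (0, x2) = Some w2"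
    using 1 2 by blast
  \<comment> \<open>By \<open>zero\<close>, \<open>B\<close> maps \<open>(x1, 0)\<close> to the pair
    of \<open>entry11 B x1\<close> and \<open>entry21 B x1\<close>; that this pair lies in the
    domain of \<open>A\<close> gives the four summands in the first column of the formal product.
    Likewise \<open>(0, x2)\<close> gives the second column.\<close>
  then show ?thesis
    using zero by (auto simp: dom_induced_operator formal_product_def op_plus_def
        map_comp_Some_iff induced_operator_Some_iff)
qed

theorem theorem2p1:
  fixes A B :: "('a::complex_banach, 'b::complex_banach) block_matrix"
  assumes "block_operator_matrix A" and "block_operator_matrix B"
  shows "induced_operator (formal_product A B) = induced_operator A \<circ>\<^sub>m induced_operator B
     \<longleftrightarrow> has_matrix_representation (induced_operator A \<circ>\<^sub>m induced_operator B)"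
    (is "?P = ?Q \<longleftrightarrow> _")
proof
  assume "?P = ?Q"
  then show "has_matrix_representation ?Q"
    unfolding has_matrix_representation_def
    \<comment> \<open>The formal product itself is the representing matrix.\<close>
    using block_operator_matrix_formal_product[OF assms] by metis
next
  assume "has_matrix_representation ?Q"
  then obtain M where M: "block_operator_matrix M" "?Q = induced_operator M"
    unfolding has_matrix_representation_def by blast
  \<comment> \<open>The entries of \<open>M\<close> are never compared with those of the formal
    product: \<open>M\<close> only supplies the rectangular shape of \<open>dom ?Q\<close>.\<close>
  have "dom ?Q \<subseteq> dom ?P"
  proof (rule subrelI)
    fix x1 x2
    assume "(x1, x2) \<in> dom ?Q"
    then show "(x1, x2) \<in> dom ?P"
      by (metis M formal_product_dom[OF assms(2)] induced_operator_dom_components)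
  qed
  moreover have "?P \<subseteq>\<^sub>m ?Q"
    using assms(1) by (rule formal_product_map_le)
  \<comment> \<open>Both maps agree on \<open>dom ?P\<close>, which by the inclusion contains
    \<open>dom ?Q\<close>.\<close>
  ultimately have "?Q \<subseteq>\<^sub>m ?P"
    unfolding map_le_def by (metis domIff subsetD)
  with \<open>?P \<subseteq>\<^sub>m ?Q\<close> show "?P = ?Q"
    by (rule map_le_antisym)
qed

end
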